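(* Consider the first-order finite-volume scheme with explicit Euler time discretization, the Merriam-Roe inviscid flux whose entropy conservative part is Chandrashekar's flux, and the first-order artificial mass diffusion. That is, at the "$\pm$" interface of a solution point in direction $l$, with left and right states ${\bm u}_1,{\bm u}_2$ (ordered by increasing $\xi^l$) and nonzero metric vector $\hat{\bar{\vec a}}=\hat{\bar{\vec a}}{}^l_\pm$, the mass flux is $$\rho_L\,\vec V_A\cdot\hat{\bar{\vec a}}-\left(M^{\mathcal Y}({\bm u}_1,{\bm u}_2,\hat{\bar{\vec a}})\,({\bm w}_2-{\bm w}_1)\right)_\rho-\frac{\sigma\|\hat{\bar{\vec a}}\|^2}{J_G\,\Delta\xi}(\rho_2-\rho_1),$$ where $\sigma=\sigma^\pm_l\ge0$ is the mass diffusion coefficient at that interface. Set $$\mathscr D^\pm_l=\left[\lambda_c+\frac{\sigma\|\hat{\bar{\vec a}}\|^2}{J_G\Delta\xi}\right]^\pm_l,\qquad \mathscr D^\pm_{l,\min}=\left[\frac{\rho_L}{2\rho_A}\left|\vec V_A\cdot\hat{\bar{\vec a}}-\mathcal V({\bm u}_1,{\bm u}_2,\hat{\bar{\vec a}})\right|\right]^\pm_l .$$ If at every interface $$\sigma^\pm_l\ \ge\ \sigma^\pm_{l,\min}=\left[\max\left(0,\ \frac{\rho_L}{2\rho_A}\left|\vec V_A\cdot\hat{\bar{\vec a}}-\mathcal V({\bm u}_1,{\bm u}_2,\hat{\bar{\vec a}})\right|-\lambda_c\right)\frac{J_G\Delta\xi}{\|\hat{\bar{\vec a}}\|^2}\right]^\pm_l$$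 (so that $\mathscr D^\pm_l\ge\mathscr D^\pm_{l,\min}$), then the scheme preserves positivity of the density under the time step constraint $$\tau<\tau_\rho=\frac{J_{ijk}}{2\sum_{l=1}^3\frac{\mathscr D^+_l+\mathscr D^-_l}{P_l}}$$ at each solution point $\vec\xi_{ijk}$, where $P_1=\mathcal P_{i,i}$, $P_2=\mathcal P_{j,j}$, $P_3=\mathcal P_{k,k}$.
   Context: Setting: the density update at a solution point $\vec\xi_{ijk}$ is $J_{ijk}\rho^{n+1}_{ijk}=J_{ijk}\rho^n_{ijk}-\tau\sum_{l=1}^3(\hat f^{\rho+}_l-\hat f^{\rho-}_l)/P_l$, where $\hat f^{\rho\pm}_l$ are the mass fluxes at the two faces in direction $l$ at time level $n$, $J_{ijk}>0$ is the mapping Jacobian, and $\mathcal P_{i,i}>0$ are the Legendre-Gauss-Lobatto weights. At the "$+$" face ${\bm u}_1$ is the state at the point and ${\bm u}_2$ that at its neighbour; at the "$-$" face ${\bm u}_1$ is the state at the neighbour and ${\bm u}_2$ that at the point. $J_G$ is the geometric mean of the Jacobians at the two points; $\Delta\xi>0$ is the computational distance between the two solution points, or $\mathcal P_{1,1}$ at a face between two elements. "Preserves positivity" means: if all densities at level $n$ are positive (all states admissible, $\rho>0,T>0$), then $\rho^{n+1}_{ijk}>0$. Gas: ${\bm u}=(\rho,\rho\vec V,\rho E)$, $P=\rho R_gT$, $E=\frac{R_gT}{\gamma-1}+\frac12\|\vec V\|^2$, $R_g>0$, $\gamma>1$; thermodynamic entropy $s=\frac{R_g}{\gamma-1}\log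 T-R_g\log\rho$ (up to a constant), mathematical entropy $\mathcal S=-\rho s$, entropy variables ${\bm w}=(\partial\mathcal S/\partial{\bm u})^\top$. Averages of $z_1,z_2>0$: arithmetic $z_A$, geometric $z_G$, harmonic $z_H=2z_1z_2/(z_1+z_2)$, logarithmic $z_L=(z_2-z_1)/(\log z_2-\log z_1)$ ($=z_1$ if $z_1=z_2$). $\vec V_A$ is the arithmetic average of the velocities. The mass component of Chandrashekar's flux in direction $\vec n$ is $\rho_L\vec V_A\cdot\vec n$. $M^{\mathcal Y}({\bm u}_1,{\bm u}_2,\vec n)$ is $\frac12\mathcal Y|\lambda|\mathcal Y^\top$ evaluated at the averaged state with density $\rho_L$, velocity $\vec V_{avg}=\frac{\vec V_1T_2+\vec V_2T_1}{T_1+T_2}$ and temperature $T_H$; here $\mathcal Y$ consists of eigenvectors of the Euler flux Jacobian in direction $\vec n$ (with respect to conservative variables), normalized so that $\mathcal Y\mathcal Y^\top=\partial{\bm u}/\partial{\bm w}$, and $\lambda={\rm diag}(-c\|\vec n\|+\vec V\cdot\vec n,\ c\|\vec n\|+\vec V\cdot\vec n,\ \vec V\cdot\vec n,\ \vec V\cdot\vec n,\ \vec V\cdot\vec n)$, $c=\sqrt{\gamma R_gT}$. With $c_{avg}=\sqrt{\gamma R_gT_H}$, $\lambda_1=|\vec V_{avg}\cdot\vec n|$, $\lambda_2=|\vec V_{avg}\cdot\vec n-c_{avg}\|\vec n\||$, $\lambda_3=|\vec V_{avg}\cdot\vec n+c_{avg}\|\vec n\||$, set $$\lambda_c=\frac{\lambda_1(\gamma-1)}{2\gamma}+\frac{\lambda_2+\lambda_3}{4\gamma}.$$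 The quantity $\mathcal V({\bm u}_1,{\bm u}_2,\vec n)$ is determined by $$\left(M^{\mathcal Y}({\bm u}_1,{\bm u}_2,\vec n)({\bm w}_2-{\bm w}_1)\right)_\rho=\rho_L\,\mathcal V({\bm u}_1,{\bm u}_2,\vec n)+\lambda_c\,(\rho_2-\rho_1),$$ where $(\cdot)_\rho$ is the first (density) component. *)

theory Defs
  imports "HOL-Analysis.Analysis" "HOL-Computational_Algebra.Polynomial"
begin

section \<open>Averages of two positive numbers\<close>

definition arith_mean :: "real \<Rightarrow> real \<Rightarrow> real" where
  "arith_mean a b = (a + b) / 2"

definition geom_mean :: "real \<Rightarrow> real \<Rightarrow> real" where
  "geom_mean a b = sqrt (a * b)"

definition harm_mean :: "real \<Rightarrow> real \<Rightarrow> real" where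
  "harm_mean a b = 2 * a * b / (a + b)"

definition log_mean :: "real \<Rightarrow> real \<Rightarrow> real" where
  "log_mean a b = (if a = b then a else (b - a) / (ln b - ln a))"


section \<open>Ideal gas\<close>

text \<open>
  A state is the vector of conservative variables \<open>(\<rho>, \<rho>V, \<rho>E)\<close>, with components 1; 2, 3, 4; 5.
  \<open>Rg\<close> is the gas constant, \<open>\<gamma>\<close> the ratio of specific heats.
\<close>

type_synonym state = "real^5"

definition mk_state :: "real \<Rightarrow> real^3 \<Rightarrow> real \<Rightarrow> state" where
  "mk_state r m e = vector [r, m $ 1, m $ 2, m $ 3, e]"

lemma mk_state_nth [simp]:
  "mk_state r m e $ 1 = r" "mk_state r m e $ 2 = m $ 1" "mk_state r m e $ 3 = m $ 2"
  "mk_state r m e $ 4 = m $ 3" "mk_state r m e $ 5 = e"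
  unfolding mk_state_def vector_def by simp_all

definition density :: "state \<Rightarrow> real" where
  "density u = u $ 1"

definition momentum :: "state \<Rightarrow> real^3" where
  "momentum u = vector [u $ 2, u $ 3, u $ 4]"

definition velocity :: "state \<Rightarrow> real^3" where
  "velocity u = (1 / density u) *\<^sub>R momentum u"

definition spec_energy :: "state \<Rightarrow> real" where
  "spec_energy u = u $ 5 / density u"

text \<open>Solved from \<open>E = Rg T / (\<gamma> - 1) + \<parallel>V\<parallel>\<^sup>2 / 2\<close>.\<close>
definition temperature :: "real \<Rightarrow> real \<Rightarrow> state \<Rightarrow> real" where
  "temperature Rg \<gamma> u = (\<gamma> - 1) / Rg * (spec_energy u - (norm (velocity u))\<^sup>2 / 2)"

definition pressure :: "real \<Rightarrow> real \<Rightarrow> state \<Rightarrow> real" where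
  "pressure Rg \<gamma> u = density u * Rg * temperature Rg \<gamma> u"

definition admissible :: "real \<Rightarrow> real \<Rightarrow> state \<Rightarrow> bool" where
  "admissible Rg \<gamma> u \<longleftrightarrow> 0 < density u \<and> 0 < temperature Rg \<gamma> u"

definition primitive_state :: "real \<Rightarrow> real \<Rightarrow> real \<Rightarrow> real^3 \<Rightarrow> real \<Rightarrow> state" where
  "primitive_state Rg \<gamma> r V T =
     mk_state r (r *\<^sub>R V) (r * (Rg * T / (\<gamma> - 1) + (norm V)\<^sup>2 / 2))"

lemma density_primitive_state: "density (primitive_state Rg \<gamma> r V T) = r"
  by (simp add: density_def primitive_state_def)

lemma velocity_primitive_state:
  assumes "r \<noteq> 0"
  shows "velocity (primitive_state Rg \<gamma> r V T) = V"
  using assms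
  by (simp add: velocity_def density_def momentum_def primitive_state_def vec_eq_iff forall_3)

lemma temperature_primitive_state:
  assumes "r \<noteq> 0" "Rg \<noteq> 0" "\<gamma> \<noteq> 1"
  shows "temperature Rg \<gamma> (primitive_state Rg \<gamma> r V T) = T"
proof -
  have "spec_energy (primitive_state Rg \<gamma> r V T) = Rg * T / (\<gamma> - 1) + (norm V)\<^sup>2 / 2"
    using assms(1) by (simp add: spec_energy_def density_primitive_state) (simp add: primitive_state_def)
  then show ?thesis
    using assms by (simp add: temperature_def velocity_primitive_state)
qed

definition thermo_entropy :: "real \<Rightarrow> real \<Rightarrow> state \<Rightarrow> real" where
  "thermo_entropy Rg \<gamma> u = Rg / (\<gamma> - 1) * ln (temperature Rg \<gamma> u) - Rg * ln (density u)"

definition math_entropy :: "real \<Rightarrow> real \<Rightarrow> state \<Rightarrow> real" where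
  "math_entropy Rg \<gamma> u = - density u * thermo_entropy Rg \<gamma> u"

text \<open>The transposed derivative of the mathematical entropy.\<close>
definition entropy_vars :: "real \<Rightarrow> real \<Rightarrow> state \<Rightarrow> real^5" where
  "entropy_vars Rg \<gamma> u = (\<chi> k. frechet_derivative (math_entropy Rg \<gamma>) (at u) (axis k 1))"

text \<open>
  The matrix \<open>\<partial>u/\<partial>w\<close>: the Jacobian of the inverse of the change of variables \<open>u \<mapsto> w\<close>, which is
  injective on the open set of admissible states.
\<close>
definition du_dw :: "real \<Rightarrow> real \<Rightarrow> state \<Rightarrow> real^5^5" where
  "du_dw Rg \<gamma> u =
     jacobian (the_inv_into {v. admissible Rg \<gamma> v} (entropy_vars Rg \<gamma>))
              (at (entropy_vars Rg \<gamma> u))"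

definition euler_flux :: "real \<Rightarrow> real \<Rightarrow> real^3 \<Rightarrow> state \<Rightarrow> real^5" where
  "euler_flux Rg \<gamma> n u =
     (let V = velocity u; p = pressure Rg \<gamma> u in
      mk_state (density u * (V \<bullet> n))
               ((density u * (V \<bullet> n)) *\<^sub>R V + p *\<^sub>R n)
               ((density u * spec_energy u + p) * (V \<bullet> n)))"

definition sound_speed :: "real \<Rightarrow> real \<Rightarrow> real \<Rightarrow> real" where
  "sound_speed Rg \<gamma> T = sqrt (\<gamma> * Rg * T)"

definition euler_eigenvalues :: "real \<Rightarrow> real \<Rightarrow> state \<Rightarrow> real^3 \<Rightarrow> real^5" where
  "euler_eigenvalues Rg \<gamma> u n =
     (let c = sound_speed Rg \<gamma> (temperature Rg \<gamma> u); Vn = velocity u \<bullet> n in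
      vector [- c * norm n + Vn, c * norm n + Vn, Vn, Vn, Vn])"

definition diag_matrix :: "real^5 \<Rightarrow> real^5^5" where
  "diag_matrix d = (\<chi> i j. if i = j then d $ i else 0)"

text \<open>
  The columns of \<open>Y\<close> are eigenvectors of the flux Jacobian, ordered as the eigenvalues above and
  scaled by \<open>Y Y\<^sup>T = \<partial>u/\<partial>w\<close>. For a nonzero direction this leaves only an orthogonal change of
  basis in each eigenspace (the eigenvalue \<open>V \<bullet> n\<close> is triple), which does not affect \<open>Y \<bar>\<lambda>\<bar> Y\<^sup>T\<close>.
\<close>
definition scaled_eigenvectors ::
    "real \<Rightarrow> real \<Rightarrow> state \<Rightarrow> real^3 \<Rightarrow> real^5^5 \<Rightarrow> bool" where
  "scaled_eigenvectors Rg \<gamma> u n Y \<longleftrightarrow>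
     jacobian (euler_flux Rg \<gamma> n) (at u) ** Y = Y ** diag_matrix (euler_eigenvalues Rg \<gamma> u n) \<and>
     Y ** transpose Y = du_dw Rg \<gamma> u"


section \<open>Merriam-Roe dissipation at an interface\<close>

definition rho_L :: "state \<Rightarrow> state \<Rightarrow> real" where
  "rho_L u1 u2 = log_mean (density u1) (density u2)"

definition rho_A :: "state \<Rightarrow> state \<Rightarrow> real" where
  "rho_A u1 u2 = arith_mean (density u1) (density u2)"

definition T_H :: "real \<Rightarrow> real \<Rightarrow> state \<Rightarrow> state \<Rightarrow> real" where
  "T_H Rg \<gamma> u1 u2 = harm_mean (temperature Rg \<gamma> u1) (temperature Rg \<gamma> u2)"

definition V_A :: "state \<Rightarrow> state \<Rightarrow> real^3" where
  "V_A u1 u2 = (1 / 2) *\<^sub>R (velocity u1 + velocity u2)"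

definition V_avg :: "real \<Rightarrow> real \<Rightarrow> state \<Rightarrow> state \<Rightarrow> real^3" where
  "V_avg Rg \<gamma> u1 u2 =
     (let T1 = temperature Rg \<gamma> u1; T2 = temperature Rg \<gamma> u2 in
      (1 / (T1 + T2)) *\<^sub>R (T2 *\<^sub>R velocity u1 + T1 *\<^sub>R velocity u2))"

definition avg_state :: "real \<Rightarrow> real \<Rightarrow> state \<Rightarrow> state \<Rightarrow> state" where
  "avg_state Rg \<gamma> u1 u2 =
     primitive_state Rg \<gamma> (rho_L u1 u2) (V_avg Rg \<gamma> u1 u2) (T_H Rg \<gamma> u1 u2)"

text \<open>\<open>Y\<close> is a choice of the scaled eigenvectors for every state and direction.\<close>
definition dissipation_matrix ::
    "real \<Rightarrow> real \<Rightarrow> (state \<Rightarrow> real^3 \<Rightarrow> real^5^5) \<Rightarrow> state \<Rightarrow> state \<Rightarrow> real^3 \<Rightarrow> real^5^5" where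
  "dissipation_matrix Rg \<gamma> Y u1 u2 n =
     (let v = avg_state Rg \<gamma> u1 u2 in
      (1 / 2) *\<^sub>R (Y v n ** diag_matrix (\<chi> k. \<bar>euler_eigenvalues Rg \<gamma> v n $ k\<bar>)
                    ** transpose (Y v n)))"

text \<open>The density component of \<open>M (w2 - w1)\<close>.\<close>
definition mass_dissipation ::
    "real \<Rightarrow> real \<Rightarrow> (state \<Rightarrow> real^3 \<Rightarrow> real^5^5) \<Rightarrow> state \<Rightarrow> state \<Rightarrow> real^3 \<Rightarrow> real" where
  "mass_dissipation Rg \<gamma> Y u1 u2 n =
     (dissipation_matrix Rg \<gamma> Y u1 u2 n *v (entropy_vars Rg \<gamma> u2 - entropy_vars Rg \<gamma> u1)) $ 1"

definition lambda_c :: "real \<Rightarrow> real \<Rightarrow> state \<Rightarrow> state \<Rightarrow> real^3 \<Rightarrow> real" where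
  "lambda_c Rg \<gamma> u1 u2 n =
     (let Vn = V_avg Rg \<gamma> u1 u2 \<bullet> n;
          c = sound_speed Rg \<gamma> (T_H Rg \<gamma> u1 u2);
          l1 = \<bar>Vn\<bar>; l2 = \<bar>Vn - c * norm n\<bar>; l3 = \<bar>Vn + c * norm n\<bar>
      in l1 * (\<gamma> - 1) / (2 * \<gamma>) + (l2 + l3) / (4 * \<gamma>))"

text \<open>
  The solution \<open>\<V>\<close> of
  \<open>(M (w2 - w1))\<^sub>\<rho> = \<rho>\<^sub>L \<V> + \<lambda>\<^sub>c (\<rho>\<^sub>2 - \<rho>\<^sub>1)\<close>; note that \<open>\<rho>\<^sub>L > 0\<close>.
\<close>
definition diss_velocity ::
    "real \<Rightarrow> real \<Rightarrow> (state \<Rightarrow> real^3 \<Rightarrow> real^5^5) \<Rightarrow> state \<Rightarrow> state \<Rightarrow> real^3 \<Rightarrow> real" where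
  "diss_velocity Rg \<gamma> Y u1 u2 n =
     (mass_dissipation Rg \<gamma> Y u1 u2 n - lambda_c Rg \<gamma> u1 u2 n * (density u2 - density u1))
       / rho_L u1 u2"


section \<open>Multi-element Legendre-Gauss-Lobatto grid\<close>

text \<open>
  The \<open>N\<close>-point Lobatto rule on \<open>[-1, 1]\<close>, indexed from 0: the rule whose nodes include both
  end points and which has the maximal degree of exactness \<open>2N - 3\<close>.
\<close>
definition lgl_rule :: "nat \<Rightarrow> (nat \<Rightarrow> real) \<Rightarrow> (nat \<Rightarrow> real) \<Rightarrow> bool" where
  "lgl_rule N \<xi> P \<longleftrightarrow>
     2 \<le> N \<and> \<xi> 0 = -1 \<and> \<xi> (N - 1) = 1 \<and> strict_mono_on {..<N} \<xi> \<and>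
     (\<forall>p :: real poly. degree p \<le> 2 * N - 3 \<longrightarrow>
        (poly p has_integral (\<Sum>k<N. P k * poly p (\<xi> k))) {-1..1})"

text \<open>
  A solution point is an element together with the multi-index \<open>(i, j, k)\<close>, here a function on the
  three computational directions, with entries in \<open>{0..<N}\<close>. An interface \<open>(e, l, i)\<close> in direction
  \<open>l\<close> of element \<open>e\<close> has \<open>i l \<in> {0..N}\<close> and separates the positions \<open>i l - 1\<close> and \<open>i l\<close> on its
  grid line; it lies on the boundary of the element if \<open>i l = 0\<close> or \<open>i l = N\<close>.
\<close>
type_synonym 'e point = "'e \<times> (3 \<Rightarrow> nat)"
type_synonym 'e face = "'e \<times> 3 \<times> (3 \<Rightarrow> nat)"

text \<open>
  \<open>outer\<close> gives, for an interface on the boundary of an element, the point at the other side (in an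
  adjacent element, possibly a ghost element). \<open>metric\<close> is the metric vector at an interface.
\<close>
record 'e grid =
  npts :: nat
  node :: "nat \<Rightarrow> real"
  weight :: "nat \<Rightarrow> real"
  elems :: "'e set"
  outer :: "'e face \<Rightarrow> 'e point"
  jac :: "'e point \<Rightarrow> real"
  metric :: "'e face \<Rightarrow> real^3"

definition all_points :: "'e grid \<Rightarrow> 'e point set" where
  "all_points g = {(e, i). \<forall>l. i l < npts g}"

definition solution_points :: "'e grid \<Rightarrow> 'e point set" where
  "solution_points g = {(e, i) \<in> all_points g. e \<in> elems g}"

definition interfaces :: "'e grid \<Rightarrow> 'e face set" where
  "interfaces g = {(e, l, i). e \<in> elems g \<and> i l \<le> npts g \<and> (\<forall>m. m \<noteq> l \<longrightarrow> i m < npts g)}"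

text \<open>The two points adjacent to an interface, in the order of increasing \<open>\<xi>\<^sup>l\<close>.\<close>
fun left_point :: "'e grid \<Rightarrow> 'e face \<Rightarrow> 'e point" where
  "left_point g (e, l, i) = (if i l = 0 then outer g (e, l, i) else (e, i(l := i l - 1)))"

fun right_point :: "'e grid \<Rightarrow> 'e face \<Rightarrow> 'e point" where
  "right_point g (e, l, i) = (if i l = npts g then outer g (e, l, i) else (e, i))"

fun plus_face :: "'e point \<Rightarrow> 3 \<Rightarrow> 'e face" where
  "plus_face (e, i) l = (e, l, i(l := i l + 1))"

fun minus_face :: "'e point \<Rightarrow> 3 \<Rightarrow> 'e face" where
  "minus_face (e, i) l = (e, l, i)"

text \<open>\<open>weight g 0\<close> is the first weight (\<open>\<P>\<close> with index \<open>1,1\<close> when counting from 1).\<close>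
fun delta_xi :: "'e grid \<Rightarrow> 'e face \<Rightarrow> real" where
  "delta_xi g (e, l, i) =
     (if i l = 0 \<or> i l = npts g then weight g 0 else node g (i l) - node g (i l - 1))"

text \<open>Ghost elements are all elements outside \<open>elems g\<close>.\<close>
definition valid_grid :: "'e grid \<Rightarrow> bool" where
  "valid_grid g \<longleftrightarrow>
     lgl_rule (npts g) (node g) (weight g) \<and> (\<forall>k<npts g. 0 < weight g k) \<and>
     (\<forall>p\<in>all_points g. 0 < jac g p) \<and>
     (\<forall>f\<in>interfaces g. metric g f \<noteq> 0) \<and>
     (\<forall>(e, l, i)\<in>interfaces g. i l = 0 \<or> i l = npts g \<longrightarrow> outer g (e, l, i) \<in> all_points g)"

definition jac_G :: "'e grid \<Rightarrow> 'e face \<Rightarrow> real" where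
  "jac_G g f = geom_mean (jac g (left_point g f)) (jac g (right_point g f))"


section \<open>The scheme for the density\<close>

text \<open>
  In what follows \<open>u\<close> is the grid function of states at the old time level and \<open>\<sigma>\<close> the mass
  diffusion coefficient at the interfaces.
\<close>

definition mass_flux ::
    "real \<Rightarrow> real \<Rightarrow> (state \<Rightarrow> real^3 \<Rightarrow> real^5^5) \<Rightarrow> 'e grid \<Rightarrow> ('e face \<Rightarrow> real) \<Rightarrow>
     ('e point \<Rightarrow> state) \<Rightarrow> 'e face \<Rightarrow> real" where
  "mass_flux Rg \<gamma> Y g \<sigma> u f =
     (let u1 = u (left_point g f); u2 = u (right_point g f); a = metric g f in
      rho_L u1 u2 * (V_A u1 u2 \<bullet> a)
      - mass_dissipation Rg \<gamma> Y u1 u2 a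
      - \<sigma> f * (norm a)\<^sup>2 / (jac_G g f * delta_xi g f) * (density u2 - density u1))"

definition diffusion ::
    "real \<Rightarrow> real \<Rightarrow> 'e grid \<Rightarrow> ('e face \<Rightarrow> real) \<Rightarrow> ('e point \<Rightarrow> state) \<Rightarrow> 'e face \<Rightarrow> real" where
  "diffusion Rg \<gamma> g \<sigma> u f =
     (let u1 = u (left_point g f); u2 = u (right_point g f); a = metric g f in
      lambda_c Rg \<gamma> u1 u2 a + \<sigma> f * (norm a)\<^sup>2 / (jac_G g f * delta_xi g f))"

definition diffusion_min ::
    "real \<Rightarrow> real \<Rightarrow> (state \<Rightarrow> real^3 \<Rightarrow> real^5^5) \<Rightarrow> 'e grid \<Rightarrow>
     ('e point \<Rightarrow> state) \<Rightarrow> 'e face \<Rightarrow> real" where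
  "diffusion_min Rg \<gamma> Y g u f =
     (let u1 = u (left_point g f); u2 = u (right_point g f); a = metric g f in
      rho_L u1 u2 / (2 * rho_A u1 u2) * \<bar>V_A u1 u2 \<bullet> a - diss_velocity Rg \<gamma> Y u1 u2 a\<bar>)"

definition sigma_min ::
    "real \<Rightarrow> real \<Rightarrow> (state \<Rightarrow> real^3 \<Rightarrow> real^5^5) \<Rightarrow> 'e grid \<Rightarrow>
     ('e point \<Rightarrow> state) \<Rightarrow> 'e face \<Rightarrow> real" where
  "sigma_min Rg \<gamma> Y g u f =
     (let u1 = u (left_point g f); u2 = u (right_point g f); a = metric g f in
      max 0 (rho_L u1 u2 / (2 * rho_A u1 u2) * \<bar>V_A u1 u2 \<bullet> a - diss_velocity Rg \<gamma> Y u1 u2 a\<bar>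
             - lambda_c Rg \<gamma> u1 u2 a)
      * (jac_G g f * delta_xi g f / (norm a)\<^sup>2))"

text \<open>\<open>\<rho>\<close> is the density at the new time level, after one explicit Euler step of size \<open>\<tau>\<close>.\<close>
definition density_update ::
    "real \<Rightarrow> real \<Rightarrow> (state \<Rightarrow> real^3 \<Rightarrow> real^5^5) \<Rightarrow> 'e grid \<Rightarrow> ('e face \<Rightarrow> real) \<Rightarrow>
     real \<Rightarrow> ('e point \<Rightarrow> state) \<Rightarrow> ('e point \<Rightarrow> real) \<Rightarrow> bool" where
  "density_update Rg \<gamma> Y g \<sigma> \<tau> u \<rho> \<longleftrightarrow>
     (\<forall>p\<in>solution_points g.
        jac g p * \<rho> p = jac g p * density (u p)
          - \<tau> * (\<Sum>l\<in>UNIV. (mass_flux Rg \<gamma> Y g \<sigma> u (plus_face p l)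
                            - mass_flux Rg \<gamma> Y g \<sigma> u (minus_face p l)) / weight g (snd p l)))"

definition tau_rho ::
    "real \<Rightarrow> real \<Rightarrow> 'e grid \<Rightarrow> ('e face \<Rightarrow> real) \<Rightarrow> ('e point \<Rightarrow> state) \<Rightarrow> 'e point \<Rightarrow> real" where
  "tau_rho Rg \<gamma> g \<sigma> u p =
     jac g p / (2 * (\<Sum>l\<in>UNIV. (diffusion Rg \<gamma> g \<sigma> u (plus_face p l)
                               + diffusion Rg \<gamma> g \<sigma> u (minus_face p l)) / weight g (snd p l)))"

end

theory Submission
  imports Defs
begin

text \<open>
  The defining relation of the dissipation velocity \<open>\<V>\<close> absorbs the Merriam-Roe dissipation into the
  two other terms of the mass flux: at every interface the flux is
  \<open>\<rho>\<^sub>L b - D (\<rho>\<^sub>2 - \<rho>\<^sub>1)\<close> with \<open>b = V\<^sub>A \<bullet> a - \<V>\<close> and the total diffusion coefficient \<open>D\<close>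
  (lemma \<open>mass_flux_advection_diffusion\<close>). The lower bound on \<open>\<sigma>\<close> makes \<open>D\<close> dominate the
  advective part: \<open>\<bar>\<rho>\<^sub>L b\<bar> \<le> 2 \<rho>\<^sub>A D = (\<rho>\<^sub>1 + \<rho>\<^sub>2) D\<close>. As in the classical argument for the
  Lax-Friedrichs flux, the density at the far side of the interface then cancels: the flux is at most
  \<open>2 D \<rho>\<^sub>1\<close> and at least \<open>- 2 D \<rho>\<^sub>2\<close> (lemma \<open>mass_flux_bounds\<close>), so that the rate at which mass
  leaves a point through one of its faces is at most \<open>2 D\<close> times the density at this point. Summed over
  the six faces of a point, each divided by its weight, the outflow in a time \<open>\<tau>\<close> is at
  most \<open>\<tau> J / \<tau>\<^sub>\<rho>\<close> times its density, which is less than the mass \<open>J \<rho>\<close> present there as soon as \<open>\<tau> < \<tau>\<^sub>\<rho>\<close>.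
\<close>

lemma log_mean_pos:
  assumes "0 < a" "0 < b"
  shows "0 < log_mean a b"
proof (cases a b rule: linorder_cases)
  case less
  with assms have "ln a < ln b" by simp
  with less show ?thesis by (simp add: log_mean_def)
next
  case equal
  with assms show ?thesis by (simp add: log_mean_def)
next
  case greater
  with assms have "ln b < ln a" by simp
  with greater show ?thesis by (simp add: log_mean_def divide_neg_neg)
qed

lemma geom_mean_pos: "0 < a \<Longrightarrow> 0 < b \<Longrightarrow> 0 < geom_mean a b"
  by (simp add: geom_mean_def)

section \<open>Geometry of the grid\<close>

lemma left_point_in_all_points:
  assumes "valid_grid g" "f \<in> interfaces g"
  shows "left_point g f \<in> all_points g"
proof -
  obtain e l i where f: "f = (e, l, i)" by (cases f) auto
  show ?thesis
  proof (cases "i l = 0")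
    case True
    then show ?thesis using assms unfolding f valid_grid_def by auto
  next
    case False
    then show ?thesis using assms(2) unfolding f interfaces_def all_points_def by auto
  qed
qed

lemma right_point_in_all_points:
  assumes "valid_grid g" "f \<in> interfaces g"
  shows "right_point g f \<in> all_points g"
proof -
  obtain e l i where f: "f = (e, l, i)" by (cases f) auto
  show ?thesis
  proof (cases "i l = npts g")
    case True
    then show ?thesis using assms unfolding f valid_grid_def by auto
  next
    case False
    then have "i m < npts g" for m
      using assms(2) unfolding f interfaces_def by (cases "m = l") auto
    with False show ?thesis unfolding f all_points_def by simp
  qed
qed

lemma jac_G_pos:
  assumes "valid_grid g" "f \<in> interfaces g"
  shows "0 < jac_G g f"
proof -
  have "\<forall>p\<in>all_points g. 0 < jac g p"
    using assms(1) by (simp add: valid_grid_def)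
  then show ?thesis
    using left_point_in_all_points[OF assms] right_point_in_all_points[OF assms]
    by (simp add: jac_G_def geom_mean_pos)
qed

lemma delta_xi_pos:
  assumes "valid_grid g" "f \<in> interfaces g"
  shows "0 < delta_xi g f"
proof -
  obtain e l i where f: "f = (e, l, i)" by (cases f) auto
  have rule: "lgl_rule (npts g) (node g) (weight g)" and w: "\<forall>k<npts g. 0 < weight g k"
    using assms(1) by (auto simp: valid_grid_def)
  show ?thesis
  proof (cases "i l = 0 \<or> i l = npts g")
    case True
    then show ?thesis using rule w by (auto simp: f lgl_rule_def)
  next
    case False
    moreover have "i l \<le> npts g" using assms(2) by (simp add: f interfaces_def)
    moreover have "strict_mono_on {..<npts g} (node g)" using rule by (simp add: lgl_rule_def)
    ultimately have "node g (i l - 1) < node g (i l)"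
      by (intro strict_mono_onD[of "{..<npts g}" "node g"]) auto
    with False show ?thesis by (simp add: f)
  qed
qed

lemma plus_face_in_interfaces:
  assumes "p \<in> solution_points g"
  shows "plus_face p l \<in> interfaces g"
  using assms
  by (cases p) (auto simp: solution_points_def all_points_def interfaces_def Suc_le_eq)

lemma minus_face_in_interfaces:
  assumes "p \<in> solution_points g"
  shows "minus_face p l \<in> interfaces g"
  using assms
  by (cases p) (auto simp: solution_points_def all_points_def interfaces_def less_imp_le)

lemma left_point_plus_face: "left_point g (plus_face p l) = p"
  by (cases p) simp

lemma right_point_minus_face:
  assumes "p \<in> solution_points g"
  shows "right_point g (minus_face p l) = p"
  using assms by (cases p) (auto simp: solution_points_def all_points_def dest: less_imp_neq)

section \<open>The mass flux at one interface\<close>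

text \<open>
  The Merriam-Roe dissipation splits into a multiple of the density jump, which joins the artificial
  diffusion, and a correction \<open>\<V>\<close> of the advection velocity.
\<close>

lemma mass_flux_advection_diffusion:
  assumes "rho_L (u (left_point g f)) (u (right_point g f)) \<noteq> 0"
  shows "mass_flux Rg \<gamma> Y g \<sigma> u f =
    rho_L (u (left_point g f)) (u (right_point g f)) *
      (V_A (u (left_point g f)) (u (right_point g f)) \<bullet> metric g f
       - diss_velocity Rg \<gamma> Y (u (left_point g f)) (u (right_point g f)) (metric g f))
    - diffusion Rg \<gamma> g \<sigma> u f *
      (density (u (right_point g f)) - density (u (left_point g f)))"
proof -
  define u1 u2 a where "u1 = u (left_point g f)" and "u2 = u (right_point g f)"
    and "a = metric g f"
  have "rho_L u1 u2 * diss_velocity Rg \<gamma> Y u1 u2 a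
      = mass_dissipation Rg \<gamma> Y u1 u2 a - lambda_c Rg \<gamma> u1 u2 a * (density u2 - density u1)"
    using assms by (simp add: diss_velocity_def u1_def u2_def)
  then show ?thesis
    unfolding mass_flux_def diffusion_def Let_def u1_def[symmetric] u2_def[symmetric] a_def[symmetric]
    by (simp only: right_diff_distrib distrib_right)
qed

text \<open>
  With the minimal coefficient the artificial diffusion supplies exactly what \<open>\<lambda>\<^sub>c\<close> lacks, and
  nothing where \<open>\<lambda>\<^sub>c\<close> is already large enough.
\<close>

lemma diffusion_min_le_diffusion:
  assumes grid: "valid_grid g" and f: "f \<in> interfaces g"
    and sigma: "sigma_min Rg \<gamma> Y g u f \<le> \<sigma> f"
  shows "diffusion_min Rg \<gamma> Y g u f \<le> diffusion Rg \<gamma> g \<sigma> u f"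
proof -
  define u1 u2 a where "u1 = u (left_point g f)" and "u2 = u (right_point g f)"
    and "a = metric g f"
  define q where "q = jac_G g f * delta_xi g f / (norm a)\<^sup>2"
  define deficit where "deficit = diffusion_min Rg \<gamma> Y g u f - lambda_c Rg \<gamma> u1 u2 a"
  have "a \<noteq> 0"
    using grid f unfolding valid_grid_def a_def by auto
  then have "0 < q"
    using jac_G_pos[OF grid f] delta_xi_pos[OF grid f] by (simp add: q_def)
  have "max 0 deficit * q \<le> \<sigma> f"
    using sigma
    by (simp add: sigma_min_def diffusion_min_def deficit_def q_def u1_def u2_def a_def Let_def)
  with \<open>0 < q\<close> have "max 0 deficit \<le> \<sigma> f / q"
    by (simp only: pos_le_divide_eq)
  then have "deficit \<le> \<sigma> f / q"
    by simp
  moreover have "diffusion Rg \<gamma> g \<sigma> u f = lambda_c Rg \<gamma> u1 u2 a + \<sigma> f / q"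
    by (simp add: diffusion_def q_def u1_def u2_def a_def Let_def)
  ultimately show ?thesis
    by (simp add: deficit_def)
qed

lemma diffusion_min_nonneg:
  assumes "0 < density (u (left_point g f))" "0 < density (u (right_point g f))"
  shows "0 \<le> diffusion_min Rg \<gamma> Y g u f"
  using assms
  by (simp add: diffusion_min_def Let_def rho_L_def rho_A_def arith_mean_def less_imp_le log_mean_pos)

text \<open>
  With \<open>D\<close> at least the minimal value the advective part lies between \<open>\<plusminus> D (\<rho>\<^sub>1 + \<rho>\<^sub>2)\<close>, and
  subtracting \<open>D (\<rho>\<^sub>2 - \<rho>\<^sub>1)\<close> cancels \<open>\<rho>\<^sub>2\<close> in the upper and \<open>\<rho>\<^sub>1\<close> in the lower bound.
\<close>

lemma mass_flux_bounds:
  assumes pos1: "0 < density (u (left_point g f))" and pos2: "0 < density (u (right_point g f))"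
    and diff: "diffusion_min Rg \<gamma> Y g u f \<le> diffusion Rg \<gamma> g \<sigma> u f"
  shows "mass_flux Rg \<gamma> Y g \<sigma> u f
           \<le> 2 * diffusion Rg \<gamma> g \<sigma> u f * density (u (left_point g f))"
    and "- (2 * diffusion Rg \<gamma> g \<sigma> u f * density (u (right_point g f)))
           \<le> mass_flux Rg \<gamma> Y g \<sigma> u f"
proof -
  define u1 u2 where "u1 = u (left_point g f)" and "u2 = u (right_point g f)"
  define D where "D = diffusion Rg \<gamma> g \<sigma> u f"
  define b where
    "b = V_A u1 u2 \<bullet> metric g f - diss_velocity Rg \<gamma> Y u1 u2 (metric g f)"
  have rho_L_pos: "0 < rho_L u1 u2"
    using pos1 pos2 by (simp add: rho_L_def u1_def u2_def log_mean_pos)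
  have sum_pos: "0 < density u1 + density u2"
    using pos1 pos2 by (simp add: u1_def u2_def)
  have two_rho_A: "2 * rho_A u1 u2 = density u1 + density u2"
    by (simp add: rho_A_def arith_mean_def)
  have "rho_L u1 u2 / (2 * rho_A u1 u2) * \<bar>b\<bar> \<le> D"
    using diff by (simp add: diffusion_min_def D_def b_def u1_def u2_def Let_def)
  with sum_pos have "rho_L u1 u2 * \<bar>b\<bar> \<le> D * (density u1 + density u2)"
    unfolding two_rho_A by (simp add: field_simps)
  with rho_L_pos have advection: "\<bar>rho_L u1 u2 * b\<bar> \<le> D * (density u1 + density u2)"
    by (simp add: abs_mult)
  have flux: "mass_flux Rg \<gamma> Y g \<sigma> u f = rho_L u1 u2 * b - D * (density u2 - density u1)"
    unfolding u1_def u2_def b_def D_def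
    using rho_L_pos by (intro mass_flux_advection_diffusion) (simp add: u1_def u2_def)
  show "mass_flux Rg \<gamma> Y g \<sigma> u f
          \<le> 2 * diffusion Rg \<gamma> g \<sigma> u f * density (u (left_point g f))"
    using advection unfolding flux u1_def[symmetric] D_def[symmetric]
    by (simp add: algebra_simps abs_le_iff)
  show "- (2 * diffusion Rg \<gamma> g \<sigma> u f * density (u (right_point g f)))
          \<le> mass_flux Rg \<gamma> Y g \<sigma> u f"
    using advection unfolding flux u2_def[symmetric] D_def[symmetric]
    by (simp add: algebra_simps abs_le_iff)
qed

section \<open>Positivity of the updated density\<close>

theorem corollary5p1:
  fixes Rg \<gamma> \<tau> :: real
    and Y :: "state \<Rightarrow> real^3 \<Rightarrow> real^5^5"
    and g :: "'e grid"
    and \<sigma> :: "'e face \<Rightarrow> real"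
    and u :: "'e point \<Rightarrow> state"
    and \<rho>_new :: "'e point \<Rightarrow> real"
  assumes gas: "0 < Rg" "1 < \<gamma>"
    and eigenvectors:
      "\<And>v n. admissible Rg \<gamma> v \<Longrightarrow> n \<noteq> 0 \<Longrightarrow> scaled_eigenvectors Rg \<gamma> v n (Y v n)"
    and grid: "valid_grid g"
    and time_step: "0 < \<tau>"
    and admissible: "\<And>p. p \<in> all_points g \<Longrightarrow> admissible Rg \<gamma> (u p)"
    and sigma_nonneg: "\<And>f. f \<in> interfaces g \<Longrightarrow> 0 \<le> \<sigma> f"
    and sigma_ge: "\<And>f. f \<in> interfaces g \<Longrightarrow> sigma_min Rg \<gamma> Y g u f \<le> \<sigma> f"
    and update: "density_update Rg \<gamma> Y g \<sigma> \<tau> u \<rho>_new"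
  shows "(\<forall>f\<in>interfaces g. diffusion_min Rg \<gamma> Y g u f \<le> diffusion Rg \<gamma> g \<sigma> u f) \<and>
         (\<forall>p\<in>solution_points g. \<tau> < tau_rho Rg \<gamma> g \<sigma> u p \<longrightarrow> 0 < \<rho>_new p)"
proof -
  have pos: "0 < density (u p)" if "p \<in> all_points g" for p
    using admissible[OF that] by (simp add: admissible_def)
  have diff: "diffusion_min Rg \<gamma> Y g u f \<le> diffusion Rg \<gamma> g \<sigma> u f" if "f \<in> interfaces g" for f
    by (rule diffusion_min_le_diffusion) (use grid that sigma_ge in auto)
  have pos_left: "0 < density (u (left_point g f))"
    and pos_right: "0 < density (u (right_point g f))" if "f \<in> interfaces g" for f
    using left_point_in_all_points[OF grid that] right_point_in_all_points[OF grid that]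
    by (simp_all add: pos)
  have diff_nonneg: "0 \<le> diffusion Rg \<gamma> g \<sigma> u f" if "f \<in> interfaces g" for f
    by (rule order_trans[OF diffusion_min_nonneg diff]) (use that in \<open>simp_all add: pos_left pos_right\<close>)
  have new_pos: "0 < \<rho>_new p"
    if p: "p \<in> solution_points g" and cfl: "\<tau> < tau_rho Rg \<gamma> g \<sigma> u p" for p
  proof -
    define F where "F = mass_flux Rg \<gamma> Y g \<sigma> u"
    define D where "D = diffusion Rg \<gamma> g \<sigma> u"
    define S where
      "S = (\<Sum>l\<in>UNIV. (D (plus_face p l) + D (minus_face p l)) / weight g (snd p l))"
    define \<rho> where "\<rho> = density (u p)"
    have p_all: "p \<in> all_points g"
      using p by (auto simp: solution_points_def)
    have "0 < \<rho>"
      using pos[OF p_all] by (simp add: \<rho>_def)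
    have J: "0 < jac g p"
      using grid p_all by (simp add: valid_grid_def)
    have weight: "0 < weight g (snd p l)" for l
      using grid p_all by (auto simp: valid_grid_def all_points_def)
    have plus: "plus_face p l \<in> interfaces g" and minus: "minus_face p l \<in> interfaces g" for l
      using p by (simp_all add: plus_face_in_interfaces minus_face_in_interfaces)
    have outflow: "F (plus_face p l) - F (minus_face p l)
        \<le> (D (plus_face p l) + D (minus_face p l)) * (2 * \<rho>)" for l
      using mass_flux_bounds(1)[OF pos_left[OF plus] pos_right[OF plus] diff[OF plus], of l]
        mass_flux_bounds(2)[OF pos_left[OF minus] pos_right[OF minus] diff[OF minus], of l]
      by (simp add: F_def D_def \<rho>_def left_point_plus_face right_point_minus_face[OF p]
          algebra_simps)
    have "(F (plus_face p l) - F (minus_face p l)) / weight g (snd p l)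
        \<le> (D (plus_face p l) + D (minus_face p l)) / weight g (snd p l) * (2 * \<rho>)" for l
      using divide_right_mono[OF outflow less_imp_le[OF weight], of l l] by simp
    then have total_outflow:
      "(\<Sum>l\<in>UNIV. (F (plus_face p l) - F (minus_face p l)) / weight g (snd p l)) \<le> S * (2 * \<rho>)"
      unfolding S_def sum_distrib_right by (intro sum_mono)
    have "0 \<le> S"
      using diff_nonneg[OF plus] diff_nonneg[OF minus] less_imp_le[OF weight]
      by (simp add: S_def D_def sum_nonneg)
    have tau: "\<tau> < jac g p / (2 * S)"
      using cfl by (simp add: tau_rho_def S_def D_def)
    \<comment> \<open>For \<open>S = 0\<close> the bound \<open>J / (2 S)\<close> is the default value 0, which excludes every positive \<open>\<tau>\<close>.\<close>
    with time_step have "S \<noteq> 0" by auto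
    with \<open>0 \<le> S\<close> tau have "\<tau> * (2 * S) < jac g p"
      by (simp add: pos_less_divide_eq)
    with \<open>0 < \<rho>\<close> have "\<tau> * (2 * S) * \<rho> < jac g p * \<rho>"
      by simp
    moreover have "jac g p * \<rho>_new p = jac g p * \<rho>
        - \<tau> * (\<Sum>l\<in>UNIV. (F (plus_face p l) - F (minus_face p l)) / weight g (snd p l))"
      using update p by (simp add: density_update_def F_def \<rho>_def)
    moreover have "\<tau> * (\<Sum>l\<in>UNIV. (F (plus_face p l) - F (minus_face p l)) / weight g (snd p l))
        \<le> \<tau> * (S * (2 * \<rho>))"
      using total_outflow time_step by simp
    ultimately have "0 < jac g p * \<rho>_new p"
      by (simp add: algebra_simps)
    with J show ?thesis
      by (simp add: zero_less_mult_iff)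
  qed
  show ?thesis
    using diff new_pos by blast
qed

end
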